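(* Let $\mathcal{V}$ be a finite ground set, let $f:2^{\mathcal{V}}\to\mathbb{R}$ be a non-decreasing submodular set function that is non-negative with $f(\emptyset)=0$ and with $f(\{v\})\neq 0$ for every $v\in\mathcal{V}$, and let $\alpha,\beta$ be integers with $0\leq\beta\leq\alpha\leq|\mathcal{V}|$. Let $$f^\star=\max_{\mathcal{A}\subseteq\mathcal{V},\,|\mathcal{A}|\leq\alpha}\;\min_{\mathcal{B}\subseteq\mathcal{A},\,|\mathcal{B}|\leq\beta} f(\mathcal{A}\setminus\mathcal{B}),$$ and for any set $\mathcal{A}\subseteq\mathcal{V}$ let $\mathcal{B}^\star(\mathcal{A})$ be an optimal removal of at most $\beta$ elements from $\mathcal{A}$, i.e., $\mathcal{B}^\star(\mathcal{A})\in\arg\min_{\mathcal{B}\subseteq\mathcal{A},\,|\mathcal{B}|\leq\beta} f(\mathcal{A}\setminus\mathcal{B})$. Let $\kappa_f$ be the curvature of $f$. Then the following two hold for Algorithm 1 (described in the context) run on the input $(\mathcal{V},f,\alpha,\beta)$: 1. Algorithm 1 returns a set $\mathcal{A}_{\mathrm{Res}}\subseteq\mathcal{V}$ such that $|\mathcal{A}_{\mathrm{Res}}|\leq\alpha$ and $$f\big(\mathcal{A}_{\mathrm{Res}}\setminus\mathcal{B}^\star(\mathcal{A}_{\mathrm{Res}})\big)\;\geq\;\max\left(1-\kappa_f,\frac{1}{\beta+1}\right)\frac{1}{\kappa_f}\left(1-e^{-\kappa_f}\right)f^\star,$$ and in particular, for $\kappa_f=0$, $f\big(\mathcal{A}_{\mathrm{Res}}\setminus\mathcal{B}^\star(\mathcal{A}_{\mathrm{Res}})\big)=f^\star$.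 2. Algorithm 1 runs in $O(|\mathcal{V}|(\alpha-\beta))$ evaluations of $f$.
   Context: Notation: for $x\in\mathcal{V}$, $f(x)$ denotes $f(\{x\})$; for $\mathcal{X},\mathcal{X}'\subseteq\mathcal{V}$, $f(\mathcal{X}|\mathcal{X}')=f(\mathcal{X}\cup\mathcal{X}')-f(\mathcal{X}')$, and $f(y|\mathcal{X}')=f(\{y\}|\mathcal{X}')$ for $y\in\mathcal{V}$. A set function $f:2^{\mathcal{V}}\to\mathbb{R}$ is non-decreasing (monotone) if $f(\mathcal{A})\leq f(\mathcal{A}')$ whenever $\mathcal{A}\subseteq\mathcal{A}'\subseteq\mathcal{V}$. It is submodular if $f(\mathcal{A})+f(\mathcal{A}')\geq f(\mathcal{A}\cup\mathcal{A}')+f(\mathcal{A}\cap\mathcal{A}')$ for all $\mathcal{A},\mathcal{A}'\subseteq\mathcal{V}$; equivalently, $f(\mathcal{A}\cup\{x\})-f(\mathcal{A})\geq f(\mathcal{A}'\cup\{x\})-f(\mathcal{A}')$ for all $\mathcal{A}\subseteq\mathcal{A}'\subseteq\mathcal{V}$ and $x\in\mathcal{V}$. Curvature: for a monotone submodular $f:2^{\mathcal{V}}\to\mathbb{R}$ with $f(v)\neq 0$ for each $v\in\mathcal{V}$, $$\kappa_f=1-\min_{v\in\mathcal{V}}\frac{f(\mathcal{V})-f(\mathcal{V}\setminus\{v\})}{f(v)}.$$ It satisfies $0\leq\kappa_f\leq 1$. For $\kappa_f=0$ the factor $\frac{1}{\kappa_f}(1-e^{-\kappa_f})$ is read as its limit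 $1$. Algorithm 1. Input: $\mathcal{V}=\{v_1,\ldots,v_m\}$ with $m=|\mathcal{V}|$, $f$, $\alpha$, $\beta$. Output: $\mathcal{A}_{\mathrm{Res}}$. (1) Set $\mathcal{A}_1\leftarrow\emptyset$, $\mathcal{A}_2\leftarrow\emptyset$. (2) Sort the elements of $\mathcal{V}$ as $v_1',v_2',\ldots,v_m'$ with $f(v_1')\geq f(v_2')\geq\cdots\geq f(v_m')$. (3) Set $\mathcal{A}_1\leftarrow\{v_1',\ldots,v_\beta'\}$. (4)-(7) While $|\mathcal{A}_2|<\alpha-\beta$: pick $x\in\arg\max_{y\in\mathcal{V}\setminus(\mathcal{A}_1\cup\mathcal{A}_2)}f(y|\mathcal{A}_2)$ and set $\mathcal{A}_2\leftarrow\{x\}\cup\mathcal{A}_2$. (8) Return $\mathcal{A}_{\mathrm{Res}}\leftarrow\mathcal{A}_1\cup\mathcal{A}_2$.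
   Formalization: In part 2 the bound O(|V|(α−β)) is stated for β<α only; for α=β, where it would be 0 although the sorting step still evaluates f on every singleton, the bound O(|V|) is stated instead. *)

theory Defs
  imports Complex_Main "HOL-Library.Multiset"
begin

section \<open>Submodular functions, curvature and the resilient maximization problem\<close>

definition submodular_on :: "'a set \<Rightarrow> ('a set \<Rightarrow> real) \<Rightarrow> bool" where
  "submodular_on V f \<longleftrightarrow>
     (\<forall>A A'. A \<subseteq> V \<and> A' \<subseteq> V \<longrightarrow> f A + f A' \<ge> f (A \<union> A') + f (A \<inter> A'))"

definition resilient_problem :: "'a set \<Rightarrow> ('a set \<Rightarrow> real) \<Rightarrow> nat \<Rightarrow> nat \<Rightarrow> bool" where
  "resilient_problem V f \<alpha> \<beta> \<longleftrightarrow>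
     finite V \<and> mono_on (Pow V) f \<and> submodular_on V f \<and>
     (\<forall>A\<subseteq>V. f A \<ge> 0) \<and> f {} = 0 \<and> (\<forall>v\<in>V. f {v} \<noteq> 0) \<and>
     \<beta> \<le> \<alpha> \<and> \<alpha> \<le> card V"

definition curvature :: "'a set \<Rightarrow> ('a set \<Rightarrow> real) \<Rightarrow> real" where
  "curvature V f = 1 - (MIN v\<in>V. (f V - f (V - {v})) / f {v})"

text \<open>The factor \<open>(1 - exp (-\<kappa>)) / \<kappa>\<close>, read as its limit 1 at \<open>\<kappa> = 0\<close>.\<close>

definition curvature_factor :: "real \<Rightarrow> real" where
  "curvature_factor \<kappa> = (if \<kappa> = 0 then 1 else 1 / \<kappa> * (1 - exp (- \<kappa>)))"

definition optimal_value :: "'a set \<Rightarrow> ('a set \<Rightarrow> real) \<Rightarrow> nat \<Rightarrow> nat \<Rightarrow> real" where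
  "optimal_value V f \<alpha> \<beta> =
     (MAX A\<in>{A. A \<subseteq> V \<and> card A \<le> \<alpha>}. MIN B\<in>{B. B \<subseteq> A \<and> card B \<le> \<beta>}. f (A - B))"

definition optimal_removal :: "('a set \<Rightarrow> real) \<Rightarrow> nat \<Rightarrow> 'a set \<Rightarrow> 'a set \<Rightarrow> bool" where
  "optimal_removal f \<beta> A B \<longleftrightarrow> is_arg_min (\<lambda>B. f (A - B)) (\<lambda>B. B \<subseteq> A \<and> card B \<le> \<beta>) B"


section \<open>Nondeterministic computations that count oracle calls\<close>

text \<open>A computation is the set of its possible outcomes, each one paired with the number of
  oracle calls made on the way. Nondeterminism accounts for the ways of breaking ties.\<close>

type_synonym 'b comp = "('b \<times> nat) set"

definition return :: "'b \<Rightarrow> 'b comp" where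
  "return x = {(x, 0)}"

definition bind :: "'b comp \<Rightarrow> ('b \<Rightarrow> 'c comp) \<Rightarrow> 'c comp" (infixl \<open>\<bind>\<close> 54) where
  "m \<bind> k = {(y, c + d) | x y c d. (x, c) \<in> m \<and> (y, d) \<in> k x}"

text \<open>An empty choice has no outcome at all. The algorithm below never makes one when \<open>\<alpha> \<le> card V\<close>:
  the candidates of each greedy step are then a non-empty finite set.\<close>

definition any_of :: "'b set \<Rightarrow> 'b comp" where
  "any_of S = S \<times> {0}"

definition oracle_call :: "('q \<Rightarrow> 'r) \<Rightarrow> 'q \<Rightarrow> 'r comp" where
  "oracle_call f X = {(f X, 1)}"

text \<open>\<open>tabulate g xs\<close> runs \<open>g\<close> on every element of \<open>xs\<close> and pairs each element with its result.\<close>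

primrec tabulate :: "('b \<Rightarrow> 'c comp) \<Rightarrow> 'b list \<Rightarrow> ('b \<times> 'c) list comp" where
  "tabulate g [] = return []"
| "tabulate g (x # xs) = g x \<bind> (\<lambda>r. tabulate g xs \<bind> (\<lambda>ps. return ((x, r) # ps)))"


section \<open>The algorithm\<close>

text \<open>The objective function enters the algorithm only as a call-counting oracle \<open>q\<close>. The ground set
  is given by a duplicate-free enumeration \<open>vs\<close>.\<close>

definition sort_by_value :: "('a set \<Rightarrow> real comp) \<Rightarrow> 'a list \<Rightarrow> 'a list comp" where
  "sort_by_value q vs =
     tabulate (\<lambda>v. q {v}) vs \<bind> (\<lambda>ps.
     any_of {map fst ps' | ps'. mset ps' = mset ps \<and> sorted_wrt (\<lambda>p p'. snd p \<ge> snd p') ps'})"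

definition marginal :: "('a set \<Rightarrow> real comp) \<Rightarrow> 'a \<Rightarrow> 'a set \<Rightarrow> real comp" where
  "marginal q y X = q ({y} \<union> X) \<bind> (\<lambda>a. q X \<bind> (\<lambda>b. return (a - b)))"

text \<open>The greedily built set is represented by the list of its elements, which are distinct because
  each new one is taken outside the current set; so its length is the cardinality of the set.\<close>

function greedy_loop ::
  "('a set \<Rightarrow> real comp) \<Rightarrow> 'a list \<Rightarrow> 'a set \<Rightarrow> nat \<Rightarrow> 'a list \<Rightarrow> 'a list comp" where
  "greedy_loop q vs A1 k A2 =
     (if length A2 < k then
        tabulate (\<lambda>y. marginal q y (set A2)) (filter (\<lambda>y. y \<notin> A1 \<union> set A2) vs) \<bind> (\<lambda>ps.
        any_of (fst ` {p. is_arg_max snd (\<lambda>p. p \<in> set ps) p}) \<bind> (\<lambda>x.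
        greedy_loop q vs A1 k (x # A2)))
      else return A2)"
  by pat_completeness auto
termination
  by (relation "measure (\<lambda>(q, vs, A1, k, A2). k - length A2)") auto

declare greedy_loop.simps [simp del]

definition resilient_algorithm ::
  "('a set \<Rightarrow> real comp) \<Rightarrow> 'a list \<Rightarrow> nat \<Rightarrow> nat \<Rightarrow> 'a set comp" where
  "resilient_algorithm q vs \<alpha> \<beta> =
     sort_by_value q vs \<bind> (\<lambda>vs'.
     let A1 = set (take \<beta> vs') in
     greedy_loop q vs A1 (\<alpha> - \<beta>) [] \<bind> (\<lambda>A2.
     return (A1 \<union> set A2)))"

text \<open>All pairs of a set that the algorithm can return and the number of evaluations of \<open>f\<close> used.\<close>

definition algorithm_runs :: "('a set \<Rightarrow> real) \<Rightarrow> 'a list \<Rightarrow> nat \<Rightarrow> nat \<Rightarrow> ('a set \<times> nat) set" where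
  "algorithm_runs f vs \<alpha> \<beta> = resilient_algorithm (oracle_call f) vs \<alpha> \<beta>"

end

theory Submission
  imports Defs
begin

text \<open>
  Let \<open>A1\<close> be the \<open>\<beta>\<close> elements of largest singleton value, \<open>A2\<close> the \<open>\<alpha> - \<beta>\<close> greedy picks
  outside \<open>A1\<close>, \<open>A\<close> their union, \<open>B\<close> the removed set, \<open>\<kappa>\<close> the curvature and \<open>f\<^sup>*\<close> the optimal
  value. The guarantee is a product of two independent comparisons, both with \<open>f A2\<close>.

  \<^item> Greedy against the optimum. Deleting \<open>A1\<close> from an optimal resilient set is one of the admissible
    removals (after padding it to \<open>\<beta>\<close> elements), so \<open>f\<^sup>*\<close> is at most the value of some set of
    \<open>\<alpha> - \<beta>\<close> elements outside \<open>A1\<close> (\<open>optimal_value_attained_outside\<close>). Greedy selection competes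
    with that set on the same candidates, and the curvature form of the greedy theorem gives the
    factor \<open>(1 - exp (- \<kappa>)) / \<kappa>\<close> (\<open>greedy_curvature_bound\<close>).

  \<^item> What survives against greedy. At most \<open>\<beta>\<close> elements are removed and \<open>A1\<close> has \<open>\<beta>\<close> elements, so
    \<open>A1\<close> keeps at least as many elements as \<open>A2\<close> loses, and each of them has at least the singleton
    value of any element lost. As \<open>f\<close> is between \<open>1 - \<kappa>\<close> times the sum of the singleton values and
    that sum, exchanging the lost elements for surviving ones costs only a factor \<open>1 - \<kappa>\<close>
    (\<open>survivors_curvature\<close>). Alternatively, \<open>f A2\<close> is at most \<open>f (A2 - B)\<close> plus the singleton values
    of the at most \<open>\<beta>\<close> lost elements, and each of these \<open>\<beta> + 1\<close> terms is bounded by the value of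
    the survivors (\<open>survivors_cardinality\<close>).

  For \<open>\<kappa> = 0\<close> the bound reads \<open>f (A - B) \<ge> f\<^sup>*\<close>, and the converse holds since the returned set is
  itself feasible for the resilient problem. The number of evaluations is \<open>card V\<close> for sorting and
  at most \<open>2 * card V\<close> for each of the \<open>\<alpha> - \<beta>\<close> greedy steps.

  The greedy theorem is proved by induction on the picks, where one pick turns the problem into the
  same problem for the contracted function \<open>\<lambda>X. f (P \<union> X) - f P\<close>. Two quantities must then be
  allowed to differ: the number of picks left and the bound \<open>k\<close> on the size of the competing set
  \<open>S\<close>. A pick outside \<open>S\<close> uses up one pick but leaves \<open>S\<close> as large as before, while a pick inside
  \<open>S\<close> decreases both numbers (\<open>greedy_gain\<close>).
\<close>

section \<open>Monotone submodular functions\<close>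

locale normalized_monotone_submodular =
  fixes V :: "'a set" and f :: "'a set \<Rightarrow> real"
  assumes finite_ground: "finite V"
    and mono_f: "mono_on (Pow V) f"
    and submodular: "submodular_on V f"
    and f_empty: "f {} = 0"
begin

lemma finite_subset_ground: "A \<subseteq> V \<Longrightarrow> finite A"
  using finite_ground finite_subset by blast

lemma f_mono: "A \<subseteq> B \<Longrightarrow> B \<subseteq> V \<Longrightarrow> f A \<le> f B"
  using mono_f by (auto simp: mono_on_def)

lemma f_nonneg: "A \<subseteq> V \<Longrightarrow> 0 \<le> f A"
  using f_mono[of "{}" A] f_empty by simp

lemma diminishing_returns:
  assumes "A \<subseteq> B" "B \<subseteq> V" "x \<in> V" "x \<notin> B"
  shows "f (insert x B) - f B \<le> f (insert x A) - f A"
proof -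
  have "insert x A \<inter> B = A" "insert x A \<union> B = insert x B"
    using assms by auto
  moreover have "f (insert x A \<union> B) + f (insert x A \<inter> B) \<le> f (insert x A) + f B"
    using submodular assms unfolding submodular_on_def by (meson insert_subset subset_trans)
  ultimately show ?thesis by simp
qed

lemma union_gain_le_sum_gains:
  assumes "P \<subseteq> V" "S \<subseteq> V"
  shows "f (P \<union> S) - f P \<le> (\<Sum>s\<in>S. f (insert s P) - f P)"
  using finite_subset_ground[OF assms(2)] assms(2)
proof (induction S rule: finite_induct)
  case empty
  then show ?case by simp
next
  case (insert x S)
  have "f (insert x (P \<union> S)) - f (P \<union> S) \<le> f (insert x P) - f P"
  proof (cases "x \<in> P \<union> S")
    case True
    then have "insert x (P \<union> S) = P \<union> S" by auto
    then show ?thesis using f_mono[of P "insert x P"] insert.prems assms(1) by auto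
  next
    case False
    then show ?thesis using diminishing_returns[of P "P \<union> S" x] insert.prems assms(1) by auto
  qed
  then show ?case using insert by simp
qed

lemma f_le_sum_singletons: "S \<subseteq> V \<Longrightarrow> f S \<le> (\<Sum>s\<in>S. f {s})"
  using union_gain_le_sum_gains[of "{}" S] f_empty by simp

end

text \<open>The parameter \<open>c\<close> is any upper bound on the curvature that is at most 1. The freedom to take it
  larger than the curvature lets the modular case be reached as a limit of positive values.\<close>

locale bounded_curvature = normalized_monotone_submodular +
  fixes c :: real
  assumes c_nonneg: "0 \<le> c" and c_le_1: "c \<le> 1"
    and removal_loss: "v \<in> V \<Longrightarrow> (1 - c) * f {v} \<le> f V - f (V - {v})"
begin

text \<open>By diminishing returns, an element gains least when it is added last, to \<open>V - {x}\<close>; that gain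
  is what the curvature controls.\<close>

lemma gain_ge_singleton:
  assumes "A \<subseteq> V" "x \<in> V" "x \<notin> A"
  shows "(1 - c) * f {x} \<le> f (insert x A) - f A"
proof -
  have "insert x (V - {x}) = V" using assms by auto
  then have "f V - f (V - {x}) \<le> f (insert x A) - f A"
    using diminishing_returns[of A "V - {x}" x] assms by auto
  then show ?thesis using removal_loss[OF assms(2)] by simp
qed

lemma sum_singletons_le:
  assumes "S \<subseteq> V"
  shows "(1 - c) * (\<Sum>s\<in>S. f {s}) \<le> f S"
  using finite_subset_ground[OF assms] assms
proof (induction S rule: finite_induct)
  case empty
  then show ?case using f_empty by simp
next
  case (insert x S)
  then show ?case using gain_ge_singleton[of S x] by (simp add: distrib_left)
qed

end

section \<open>The greedy bound\<close>

text \<open>Here \<open>P\<close> is the set chosen before the picks in the list, head first, are added. The marginal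
  gains on top of \<open>P\<close> are compared through \<open>f (insert y P)\<close>, from which they differ by the same
  amount \<open>f P\<close>.\<close>

primrec greedy_picks :: "('a set \<Rightarrow> real) \<Rightarrow> 'a set \<Rightarrow> 'a set \<Rightarrow> 'a list \<Rightarrow> bool" where
  "greedy_picks f C P [] \<longleftrightarrow> True"
| "greedy_picks f C P (x # xs) \<longleftrightarrow>
     x \<in> C - P \<and> (\<forall>y\<in>C - P. f (insert y P) \<le> f (insert x P)) \<and> greedy_picks f C (insert x P) xs"

lemma greedy_picks_subset: "greedy_picks f C P xs \<Longrightarrow> set xs \<subseteq> C - P"
  by (induction xs arbitrary: P) auto

text \<open>The arithmetic of a pick with gain \<open>\<rho>\<close> outside the competing set, where \<open>D\<close> is the gain of that
  set, \<open>R\<close> the gain of the remaining picks, and \<open>a\<close> the quotient of their number by \<open>k\<close>. Adding the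
  pick lowers \<open>D\<close> by at most \<open>c * \<rho>\<close>. All inequalities of this part are multiplied by \<open>c\<close>, so that
  no division by \<open>c\<close> occurs.\<close>

lemma greedy_step_missing:
  fixes c \<rho> D R a :: real and k :: real
  assumes "0 \<le> D" "D \<le> k * \<rho>" "0 \<le> c" "0 < k"
    and rest: "(1 - exp (- (c * a))) * (D - c * \<rho>) \<le> c * R"
  shows "(1 - exp (- (c * (a + 1 / k)))) * D \<le> c * (\<rho> + R)"
proof -
  let ?e = "exp (- (c * a))"
  have "1 - c / k \<le> exp (- (c / k))" using exp_ge_add_one_self[of "- (c / k)"] by simp
  then have "?e * (1 - c / k) \<le> ?e * exp (- (c / k))" by simp
  also have "\<dots> = exp (- (c * (a + 1 / k)))"
    by (simp add: exp_add[symmetric] algebra_simps)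
  finally have "(1 - exp (- (c * (a + 1 / k)))) * D \<le> (1 - ?e * (1 - c / k)) * D"
    using \<open>0 \<le> D\<close> by (intro mult_right_mono) auto
  also have "\<dots> = (1 - ?e) * D + (c * ?e) * (D / k)" by (simp add: algebra_simps)
  also have "\<dots> \<le> (1 - ?e) * D + (c * ?e) * \<rho>"
    using assms by (intro add_left_mono mult_left_mono) (auto simp: field_simps)
  also have "\<dots> = c * \<rho> + (1 - ?e) * (D - c * \<rho>)" by (simp add: algebra_simps)
  also have "\<dots> \<le> c * (\<rho> + R)" using rest by (simp add: algebra_simps)
  finally show ?thesis .
qed

text \<open>The arithmetic of a pick inside the competing set, which lowers \<open>D\<close> by all of \<open>\<rho>\<close>, but also
  lowers \<open>k\<close>. With \<open>l\<close> picks left, \<open>t\<close> stands for \<open>(l - 1) / (k - 1)\<close>, and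
  \<open>t + (1 - t) / k\<close> is then \<open>l / k\<close>. Replacing \<open>\<rho>\<close> by its lower bound \<open>D / k\<close> and the
  factor \<open>exp (- c * (1 - t) / k)\<close> by its tangent reduces the claim to
  \<open>1 - c \<le> exp (- c * t) * (1 - c * (1 - t))\<close>, which follows from \<open>exp (- c * t) \<ge> 1 - c * t\<close>.\<close>

lemma greedy_step_hit:
  fixes c \<rho> D R t :: real and k :: real
  assumes "0 \<le> D" "D \<le> k * \<rho>" "0 \<le> c" "c \<le> 1" "1 \<le> k" "0 \<le> t" "t \<le> 1"
    and rest: "(1 - exp (- (c * t))) * (D - \<rho>) \<le> c * R"
  shows "(1 - exp (- (c * (t + (1 - t) / k)))) * D \<le> c * (\<rho> + R)"
proof -
  let ?E = "exp (- (c * t))"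
  have E: "1 - c * t \<le> ?E" using exp_ge_add_one_self[of "- (c * t)"] by simp
  have ct: "c * t \<le> c" using assms mult_left_le by blast
  have "1 - c \<le> 1 - c + c\<^sup>2 * (t * (1 - t))" using assms by simp
  also have "\<dots> = (1 - c * t) * (1 - c * (1 - t))" by (simp add: algebra_simps power2_eq_square)
  also have "\<dots> \<le> ?E * (1 - c * (1 - t))"
  proof (rule mult_right_mono[OF E])
    have "c * (1 - t) \<le> 1 * 1" using assms by (intro mult_mono) auto
    then show "0 \<le> 1 - c * (1 - t)" by simp
  qed
  finally have "(1 - c) / k \<le> ?E * (1 - c * (1 - t)) / k"
    using assms by (intro divide_right_mono) auto
  then have "?E - (?E - (1 - c)) / k \<le> ?E * (1 - c * ((1 - t) / k))"
    by (simp add: algebra_simps diff_divide_distrib add_divide_distrib)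
  also have "\<dots> \<le> ?E * exp (- (c * ((1 - t) / k)))"
    using exp_ge_add_one_self[of "- (c * ((1 - t) / k))"] by simp
  also have "\<dots> = exp (- (c * (t + (1 - t) / k)))"
    by (simp add: exp_add[symmetric] algebra_simps)
  finally have "(1 - exp (- (c * (t + (1 - t) / k)))) * D \<le> (1 - (?E - (?E - (1 - c)) / k)) * D"
    using \<open>0 \<le> D\<close> by (intro mult_right_mono) auto
  also have "\<dots> = (1 - ?E) * D + (?E - (1 - c)) * (D / k)"
    by (simp add: algebra_simps add_divide_distrib diff_divide_distrib)
  also have "\<dots> \<le> (1 - ?E) * D + (?E - (1 - c)) * \<rho>"
    using assms E ct by (intro add_left_mono mult_left_mono) (auto simp: field_simps)
  also have "\<dots> = c * \<rho> + (1 - ?E) * (D - \<rho>)" by (simp add: algebra_simps)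
  also have "\<dots> \<le> c * (\<rho> + R)" using rest by (simp add: algebra_simps)
  finally show ?thesis .
qed

context bounded_curvature
begin

text \<open>The greedy choice and submodularity make the first gain at least \<open>1 / k\<close> of the gain of \<open>S\<close>;
  the induction hypothesis for \<open>insert x P\<close> bounds the rest. If \<open>x\<close> is in \<open>S\<close>, it is applied to
  \<open>S - {x}\<close> with \<open>k - 1\<close>, and \<open>length xs \<le> k\<close> is what keeps \<open>t \<le> 1\<close> in the arithmetic of that
  case. For \<open>k = 1\<close> the quotient with denominator \<open>k - 1\<close> is 0, which is the right value of \<open>t\<close>,
  as no picks are left.\<close>

lemma greedy_gain:
  assumes "greedy_picks f C P xs" "C \<subseteq> V" "P \<subseteq> V" "S \<subseteq> C - P" "card S \<le> k" "length xs \<le> k"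
  shows "(1 - exp (- (c * (real (length xs) / real k)))) * (f (P \<union> S) - f P)
           \<le> c * (f (P \<union> set xs) - f P)"
  using assms
proof (induction xs arbitrary: P S k)
  case Nil
  then show ?case by simp
next
  case (Cons x xs)
  have x: "x \<in> V" "x \<notin> P" and SV: "S \<subseteq> V" and P'V: "insert x P \<subseteq> V"
    and max: "\<And>y. y \<in> S \<Longrightarrow> f (insert y P) \<le> f (insert x P)"
    and picks: "greedy_picks f C (insert x P) xs" and k: "1 \<le> k" "length xs \<le> k - 1"
    using Cons.prems by auto
  let ?D = "f (P \<union> S) - f P" and ?\<rho> = "f (insert x P) - f P"
    and ?R = "f (insert x P \<union> set xs) - f (insert x P)"
  have \<rho>: "0 \<le> ?\<rho>" using f_mono[of P "insert x P"] P'V by auto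
  have D: "0 \<le> ?D" using f_mono[of P "P \<union> S"] Cons.prems SV by auto
  have "?D \<le> (\<Sum>s\<in>S. f (insert s P) - f P)"
    using union_gain_le_sum_gains Cons.prems SV by blast
  also have "\<dots> \<le> real (card S) * ?\<rho>"
    using max by (intro sum_bounded_above) auto
  also have "\<dots> \<le> real k * ?\<rho>"
    using \<rho> Cons.prems by (intro mult_right_mono) auto
  finally have Dk: "?D \<le> real k * ?\<rho>" .
  have split: "f (P \<union> set (x # xs)) - f P = ?\<rho> + ?R" by simp
  show ?case
  proof (cases "x \<in> S")
    \<comment> \<open>Adding \<open>x\<close> to \<open>P \<union> S\<close> still gains \<open>(1 - c)\<close> times its gain on \<open>P\<close>, so of the gain of \<open>S\<close>
      at least all but \<open>c\<close> times the gain of \<open>x\<close> is left after the pick.\<close>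
    case False
    then have "(1 - c) * f {x} \<le> f (insert x (P \<union> S)) - f (P \<union> S)"
      using gain_ge_singleton[of "P \<union> S" x] x SV Cons.prems by auto
    moreover have "(1 - c) * ?\<rho> \<le> (1 - c) * f {x}"
      using diminishing_returns[of "{}" P x] x Cons.prems c_le_1 f_empty
      by (intro mult_left_mono) auto
    ultimately have left: "?D - c * ?\<rho> \<le> f (insert x P \<union> S) - f (insert x P)"
      by (simp add: algebra_simps)
    let ?a = "real (length xs) / real k"
    have "0 \<le> c * ?a" using c_nonneg by simp
    then have "(1 - exp (- (c * ?a))) * (?D - c * ?\<rho>)
        \<le> (1 - exp (- (c * ?a))) * (f (insert x P \<union> S) - f (insert x P))"
      using left by (intro mult_left_mono) auto
    also have "\<dots> \<le> c * ?R"
      using Cons.IH[of "insert x P" S k] picks Cons.prems P'V False by auto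
    finally have "(1 - exp (- (c * (?a + 1 / real k)))) * ?D \<le> c * (?\<rho> + ?R)"
      using k D Dk c_nonneg by (intro greedy_step_missing) auto
    moreover have "real (length (x # xs)) / real k = ?a + 1 / real k"
      by (simp add: add_divide_distrib)
    ultimately show ?thesis unfolding split by simp
  next
    case True
    let ?t = "real (length xs) / real (k - 1)"
    have "insert x P \<union> (S - {x}) = P \<union> S" using True by auto
    moreover have "card (S - {x}) \<le> k - 1"
      using True Cons.prems by (simp add: card_Diff_singleton)
    ultimately have "(1 - exp (- (c * ?t))) * (f (P \<union> S) - f (insert x P)) \<le> c * ?R"
      using Cons.IH[of "insert x P" "S - {x}" "k - 1"] picks Cons.prems P'V k by auto
    then have "(1 - exp (- (c * ?t))) * (?D - ?\<rho>) \<le> c * ?R" by simp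
    moreover have "?t \<le> 1" using k by (auto simp: divide_le_eq_1)
    ultimately have "(1 - exp (- (c * (?t + (1 - ?t) / real k)))) * ?D \<le> c * (?\<rho> + ?R)"
      using k D Dk c_nonneg c_le_1 by (intro greedy_step_hit) auto
    moreover have "real (length (x # xs)) / real k = ?t + (1 - ?t) / real k"
    proof (cases "k = 1")
      case True
      then show ?thesis using k by simp
    next
      case False
      then have "real (length xs) = ?t * (real k - 1)" using k by (simp add: of_nat_diff)
      then have pick: "real (length (x # xs)) / real k = (?t * (real k - 1) + 1) / real k" by simp
      have "(t * (n - 1) + 1) / n = t + (1 - t) / n" if "1 \<le> n" for t n :: real
        using that by (simp add: field_simps)
      then show ?thesis unfolding pick using k by (metis of_nat_1 of_nat_mono)
    qed
    ultimately show ?thesis unfolding split by simp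
  qed
qed

lemma greedy_bound:
  assumes "greedy_picks f C {} xs" "C \<subseteq> V" "S \<subseteq> C" "card S \<le> length xs"
  shows "(1 - exp (- c)) * f S \<le> c * f (set xs)"
proof (cases "xs = []")
  case True
  then have "S = {}" using assms finite_subset_ground[of S] by auto
  then show ?thesis using f_empty True by simp
next
  case False
  then show ?thesis using greedy_gain[of C "{}" xs S "length xs"] assms f_empty by simp
qed

end

text \<open>For \<open>c = 0\<close> both sides of \<open>greedy_bound\<close> vanish. But a curvature of 0 is bounded by every
  positive \<open>c\<close>, and the factor \<open>(1 - exp (- c)) / c\<close> is at least \<open>1 - c\<close>, hence arbitrarily close
  to 1.\<close>

lemma (in normalized_monotone_submodular) greedy_optimal_if_modular:
  assumes "bounded_curvature V f 0"
    and "greedy_picks f C {} xs" "C \<subseteq> V" "S \<subseteq> C" "card S \<le> length xs"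
  shows "f S \<le> f (set xs)"
proof (rule field_le_mult_one_interval)
  fix z :: real
  assume z: "0 < z" "z < 1"
  define c where "c = 1 - z"
  have c: "0 < c" "c < 1" using z by (auto simp: c_def)
  have fS: "0 \<le> f S" using f_nonneg assms by auto
  interpret modular: bounded_curvature V f 0 by fact
  have "(1 - c) * f {v} \<le> f V - f (V - {v})" if "v \<in> V" for v
  proof -
    have "0 \<le> c * f {v}" using f_nonneg[of "{v}"] that c by simp
    then show ?thesis using modular.removal_loss[OF that] by (simp add: algebra_simps)
  qed
  then interpret bounded_curvature V f c by unfold_locales (use c in auto)
  have "c * exp (- c) \<le> 1 - exp (- c)"
  proof -
    have "exp (- c) * (1 + c) \<le> exp (- c) * exp c"
      by (intro mult_left_mono exp_ge_add_one_self) auto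
    then show ?thesis by (simp add: algebra_simps flip: exp_add)
  qed
  moreover have "c * z \<le> c * exp (- c)"
    using c exp_ge_add_one_self[of "- c"] by (simp add: c_def)
  ultimately have "c * z * f S \<le> (1 - exp (- c)) * f S"
    using fS by (intro mult_right_mono) auto
  also have "\<dots> \<le> c * f (set xs)" using greedy_bound assms by blast
  finally show "z * f S \<le> f (set xs)" using c by simp
qed

lemma (in bounded_curvature) greedy_curvature_bound:
  assumes "greedy_picks f C {} xs" "C \<subseteq> V" "S \<subseteq> C" "card S \<le> length xs"
  shows "curvature_factor c * f S \<le> f (set xs)"
proof (cases "c = 0")
  case True
  then have "bounded_curvature V f 0" using bounded_curvature_axioms by simp
  then show ?thesis
    using greedy_optimal_if_modular assms True by (simp add: curvature_factor_def)
next
  case False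
  then have "c > 0" using c_nonneg by simp
  then show ?thesis
    using greedy_bound[OF assms] by (simp add: curvature_factor_def field_simps)
qed

section \<open>Surviving a removal\<close>

lemma sum_le_sum_if_dominated:
  fixes g :: "'a \<Rightarrow> real"
  assumes "finite X" "finite Y" "card X \<le> card Y"
    and "\<And>x y. x \<in> X \<Longrightarrow> y \<in> Y \<Longrightarrow> g x \<le> g y" and "\<And>y. y \<in> Y \<Longrightarrow> 0 \<le> g y"
  shows "sum g X \<le> sum g Y"
proof -
  obtain h where h: "inj_on h X" "h ` X \<subseteq> Y"
    using assms inj_on_iff_card_le by metis
  have "sum g X \<le> (\<Sum>x\<in>X. g (h x))" using h assms by (intro sum_mono) auto
  also have "\<dots> = sum g (h ` X)" using h by (simp add: sum.reindex)
  also have "\<dots> \<le> sum g Y" using h assms by (intro sum_mono2) auto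
  finally show ?thesis .
qed

text \<open>The set \<open>A1\<close> of elements of large value shields the valuable set \<open>A2\<close> against the removal of
  \<open>B\<close>: removing many elements from \<open>A2\<close> leaves many elements of \<open>A1\<close>.\<close>

locale shielded_set = normalized_monotone_submodular +
  fixes A1 A2 B :: "'a set" and \<beta> :: nat
  assumes shield_sub: "A1 \<subseteq> V" and core_sub: "A2 \<subseteq> V" and disjoint: "A1 \<inter> A2 = {}"
    and shield_card: "card A1 = \<beta>"
    and shield_dominates: "a \<in> A1 \<Longrightarrow> b \<in> A2 \<Longrightarrow> f {b} \<le> f {a}"
    and removed_sub: "B \<subseteq> A1 \<union> A2" and removed_card: "card B \<le> \<beta>"
begin

lemma card_removed_core_le: "card (B \<inter> A2) \<le> card (A1 - B)"
proof -
  have fin: "finite A1" "finite B"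
    using shield_sub core_sub removed_sub finite_subset_ground[of A1] finite_subset_ground[of B] by auto
  have "B - A1 = B \<inter> A2" using removed_sub disjoint by auto
  then have "card B = card (B \<inter> A1) + card (B \<inter> A2)"
    using card_Int_Diff[OF fin(2), of A1] by simp
  moreover have "card A1 = card (B \<inter> A1) + card (A1 - B)"
    using card_Int_Diff[OF fin(1), of B] by (simp add: Int_commute)
  ultimately show ?thesis using shield_card removed_card by simp
qed

text \<open>On sums of singleton values the surviving part of \<open>A1\<close> compensates for the loss in \<open>A2\<close>; passing
  from \<open>f\<close> to such sums is free, and passing back costs the factor \<open>1 - c\<close>.\<close>

lemma survivors_curvature:
  assumes "bounded_curvature V f c"
  shows "(1 - c) * f A2 \<le> f (A1 \<union> A2 - B)"
proof -
  interpret bounded_curvature V f c by fact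
  have fin: "finite A1" "finite A2" using shield_sub core_sub finite_subset_ground by auto
  have "f A2 \<le> (\<Sum>v\<in>A2. f {v})" using f_le_sum_singletons core_sub by auto
  also have "\<dots> = (\<Sum>v\<in>A2 - B. f {v}) + (\<Sum>v\<in>B \<inter> A2. f {v})"
    using sum.Int_Diff[OF fin(2), of "\<lambda>v. f {v}" B] by (simp add: Int_commute)
  also have "\<dots> \<le> (\<Sum>v\<in>A2 - B. f {v}) + (\<Sum>v\<in>A1 - B. f {v})"
    using fin card_removed_core_le shield_dominates shield_sub
    by (intro add_left_mono sum_le_sum_if_dominated) (auto intro!: f_nonneg)
  also have "\<dots> = (\<Sum>v\<in>(A2 - B) \<union> (A1 - B). f {v})"
    using fin disjoint by (subst sum.union_disjoint) auto
  also have "(A2 - B) \<union> (A1 - B) = A1 \<union> A2 - B" by auto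
  finally have "(1 - c) * f A2 \<le> (1 - c) * (\<Sum>v\<in>A1 \<union> A2 - B. f {v})"
    using c_le_1 by (intro mult_left_mono) auto
  also have "\<dots> \<le> f (A1 \<union> A2 - B)"
    using shield_sub core_sub by (intro sum_singletons_le) auto
  finally show ?thesis .
qed

text \<open>If \<open>A2\<close> loses an element \<open>b\<close> at all, then some \<open>a\<close> in \<open>A1\<close> survives, and the survivors are worth at
  least \<open>f {a}\<close>, hence at least \<open>f {b}\<close>. The lost elements thus contribute at most \<open>\<beta>\<close> times the value
  of the survivors to \<open>f A2\<close>, and \<open>A2 - B\<close> contributes at most once that value.\<close>

lemma survivors_cardinality: "f A2 \<le> (real \<beta> + 1) * f (A1 \<union> A2 - B)"
proof -
  let ?s = "f (A1 \<union> A2 - B)"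
  have fin: "finite A1" "finite A2" using shield_sub core_sub finite_subset_ground by auto
  have survivor: "f X \<le> ?s" if "X \<subseteq> A1 \<union> A2 - B" for X
    using that shield_sub core_sub by (intro f_mono) auto
  have removed: "f {b} \<le> ?s" if b: "b \<in> B \<inter> A2" for b
  proof -
    have "card (B \<inter> A2) > 0" using b fin by (auto simp: card_gt_0_iff)
    then have "A1 - B \<noteq> {}" using card_removed_core_le by (metis card.empty not_le)
    then obtain a where "a \<in> A1 - B" by auto
    then show ?thesis using shield_dominates[of a b] survivor[of "{a}"] b by auto
  qed
  have "card (B \<inter> A2) \<le> \<beta>"
    using card_removed_core_le shield_card card_mono[OF fin(1), of "A1 - B"] by auto
  moreover have "0 \<le> ?s" using survivor[of "{}"] f_empty by simp
  ultimately have bound: "real (card (B \<inter> A2)) * ?s \<le> real \<beta> * ?s"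
    by (intro mult_right_mono) auto
  have "f ((A2 - B) \<union> (B \<inter> A2)) - f (A2 - B) \<le> (\<Sum>b\<in>B \<inter> A2. f (insert b (A2 - B)) - f (A2 - B))"
    using core_sub by (intro union_gain_le_sum_gains) auto
  also have "\<dots> \<le> (\<Sum>b\<in>B \<inter> A2. f {b})"
    using core_sub f_empty diminishing_returns[of "{}" "A2 - B"] by (intro sum_mono) auto
  also have "\<dots> \<le> real (card (B \<inter> A2)) * ?s"
    using removed by (intro sum_bounded_above) auto
  also have "(A2 - B) \<union> (B \<inter> A2) = A2" by auto
  finally have "f A2 \<le> f (A2 - B) + real \<beta> * ?s" using bound by simp
  also have "\<dots> \<le> ?s + real \<beta> * ?s" using survivor[of "A2 - B"] by auto
  finally show ?thesis by (simp add: algebra_simps)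
qed

end

section \<open>The resilient problem\<close>

lemma resilient_problem_submodular:
  "resilient_problem V f \<alpha> \<beta> \<Longrightarrow> normalized_monotone_submodular V f"
  by unfold_locales (auto simp: resilient_problem_def)

text \<open>All quotients in the minimum that defines the curvature lie between 0 and 1: the loss caused by
  removing \<open>v\<close> from \<open>V\<close> is the gain of adding \<open>v\<close> last.\<close>

lemma bounded_curvature_curvature:
  assumes "resilient_problem V f \<alpha> \<beta>" "V \<noteq> {}"
  shows "bounded_curvature V f (curvature V f)"
proof -
  interpret normalized_monotone_submodular V f
    using assms resilient_problem_submodular by blast
  let ?r = "\<lambda>v. (f V - f (V - {v})) / f {v}"
  have pos: "0 < f {v}" if "v \<in> V" for v
  proof -
    have "f {v} \<noteq> 0" using assms(1) that unfolding resilient_problem_def by blast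
    moreover have "0 \<le> f {v}" using that by (intro f_nonneg) simp
    ultimately show ?thesis by simp
  qed
  have ratio: "0 \<le> ?r v" "?r v \<le> 1" if "v \<in> V" for v
  proof -
    have "insert v (V - {v}) = V" using that by auto
    then have "f V - f (V - {v}) \<le> f {v}"
      using diminishing_returns[of "{}" "V - {v}" v] that f_empty by auto
    then show "?r v \<le> 1" using pos[OF that] by simp
    show "0 \<le> ?r v" using pos[OF that] f_mono[of "V - {v}" V] by auto
  qed
  have \<kappa>: "1 - curvature V f = Min (?r ` V)" by (simp add: curvature_def)
  have "Min (?r ` V) \<in> ?r ` V" using finite_ground assms by (intro Min_in) auto
  then have "0 \<le> 1 - curvature V f" "1 - curvature V f \<le> 1" unfolding \<kappa> using ratio by auto
  moreover have "(1 - curvature V f) * f {v} \<le> f V - f (V - {v})" if "v \<in> V" for v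
  proof -
    have "1 - curvature V f \<le> ?r v" unfolding \<kappa> using finite_ground that by auto
    then show ?thesis using pos[OF that] by (simp add: pos_le_divide_eq)
  qed
  ultimately show ?thesis by unfold_locales auto
qed

lemma optimal_value_ge_removal:
  assumes "finite V" "A \<subseteq> V" "card A \<le> \<alpha>" "optimal_removal f \<beta> A B"
  shows "f (A - B) \<le> optimal_value V f \<alpha> \<beta>"
proof -
  let ?m = "\<lambda>A. MIN B\<in>{B. B \<subseteq> A \<and> card B \<le> \<beta>}. f (A - B)"
  have "finite A" using assms finite_subset by blast
  have "f (A - B) \<le> ?m A"
  proof (rule Min.boundedI)
    show "finite ((\<lambda>B. f (A - B)) ` {B. B \<subseteq> A \<and> card B \<le> \<beta>})"
      using \<open>finite A\<close> by auto
    show "(\<lambda>B. f (A - B)) ` {B. B \<subseteq> A \<and> card B \<le> \<beta>} \<noteq> {}"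
      by (auto intro!: exI[of _ "{}"])
  qed (use assms(4) in \<open>auto simp: optimal_removal_def is_arg_min_linorder\<close>)
  also have "?m A \<le> optimal_value V f \<alpha> \<beta>"
    unfolding optimal_value_def using assms by (intro Max_ge) auto
  finally show ?thesis .
qed

text \<open>The witness is \<open>A - B\<close>, for an optimal resilient set \<open>A\<close> and an admissible removal \<open>B\<close> that
  contains \<open>A \<inter> A1\<close>. The set \<open>B\<close> must be enlarged to \<open>\<beta>\<close> elements, or to all of \<open>A\<close> if \<open>A\<close> is smaller,
  to leave at most \<open>\<alpha> - \<beta>\<close> elements.\<close>

lemma (in normalized_monotone_submodular) optimal_value_attained_outside:
  assumes "A1 \<subseteq> V" "card A1 \<le> \<beta>" "\<beta> \<le> \<alpha>"
  obtains S where "S \<subseteq> V - A1" "card S \<le> \<alpha> - \<beta>" "optimal_value V f \<alpha> \<beta> \<le> f S"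
proof -
  let ?m = "\<lambda>A. MIN B\<in>{B. B \<subseteq> A \<and> card B \<le> \<beta>}. f (A - B)"
  let ?F = "{A. A \<subseteq> V \<and> card A \<le> \<alpha>}"
  have "{} \<in> ?F" by simp
  then have "Max (?m ` ?F) \<in> ?m ` ?F"
    using finite_ground by (intro Max_in) auto
  then obtain A where A: "A \<subseteq> V" "card A \<le> \<alpha>" "optimal_value V f \<alpha> \<beta> = ?m A"
    unfolding optimal_value_def by auto
  have finA: "finite A" using A finite_subset_ground by blast
  have int: "card (A \<inter> A1) \<le> \<beta>"
    using assms card_mono[of A1 "A \<inter> A1"] finite_subset_ground[of A1] by auto
  obtain B where B: "A \<inter> A1 \<subseteq> B" "B \<subseteq> A" "card B \<le> \<beta>" "card (A - B) \<le> \<alpha> - \<beta>"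
  proof (cases "card A \<le> \<beta>")
    case True
    then show ?thesis using that[of A] by auto
  next
    case False
    then obtain B where "A \<inter> A1 \<subseteq> B" "B \<subseteq> A" "card B = \<beta>"
      using exists_subset_between[of "A \<inter> A1" \<beta> A] int finA by auto
    then show ?thesis using that[of B] A finA finite_subset[of B A] by (auto simp: card_Diff_subset)
  qed
  have "?m A \<le> f (A - B)" using finA B by (intro Min_le) auto
  then show ?thesis using that[of "A - B"] A B by auto
qed

theorem resilient_set_bound:
  assumes problem: "resilient_problem V f \<alpha> \<beta>"
    and A1: "A1 \<subseteq> V" "card A1 = \<beta>" "\<And>a b. a \<in> A1 \<Longrightarrow> b \<in> V - A1 \<Longrightarrow> f {b} \<le> f {a}"
    and picks: "greedy_picks f (V - A1) {} xs" "length xs = \<alpha> - \<beta>"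
    and B: "B \<subseteq> A1 \<union> set xs" "card B \<le> \<beta>"
  shows "max (1 - curvature V f) (1 / (real \<beta> + 1)) * curvature_factor (curvature V f)
           * optimal_value V f \<alpha> \<beta> \<le> f (A1 \<union> set xs - B)"
proof -
  interpret normalized_monotone_submodular V f
    using problem resilient_problem_submodular by blast
  let ?\<kappa> = "curvature V f" and ?s = "f (A1 \<union> set xs - B)"
  have \<beta>: "\<beta> \<le> \<alpha>" using problem by (simp add: resilient_problem_def)
  have sub: "set xs \<subseteq> V - A1" using greedy_picks_subset[OF picks(1)] by auto
  obtain S where S: "S \<subseteq> V - A1" "card S \<le> \<alpha> - \<beta>" "optimal_value V f \<alpha> \<beta> \<le> f S"
    using optimal_value_attained_outside[of A1 \<beta> \<alpha>] A1 \<beta> by auto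
  interpret shielded_set V f A1 "set xs" B \<beta>
    using A1 sub B by unfold_locales auto
  show ?thesis
  proof (cases "V = {}")
    \<comment> \<open>The curvature of the empty ground set is a minimum over the empty set, so nothing is known
      about it; but then both sides of the inequality are 0.\<close>
    case True
    have "{A. A \<subseteq> {} \<and> card A \<le> \<alpha>} = {{}}" "{B. B \<subseteq> {} \<and> card B \<le> \<beta>} = {{}}" by auto
    then have "optimal_value V f \<alpha> \<beta> = 0"
      using True f_empty by (simp add: optimal_value_def)
    then show ?thesis using f_nonneg[of "A1 \<union> set xs - B"] A1 sub by auto
  next
    case False
    then interpret bounded_curvature V f ?\<kappa>
      using problem bounded_curvature_curvature by blast
    let ?m = "max (1 - ?\<kappa>) (1 / (real \<beta> + 1))"
    have factor: "0 \<le> curvature_factor ?\<kappa>"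
      using c_nonneg by (auto simp: curvature_factor_def)
    have "curvature_factor ?\<kappa> * optimal_value V f \<alpha> \<beta> \<le> curvature_factor ?\<kappa> * f S"
      using S factor by (intro mult_left_mono)
    also have "\<dots> \<le> f (set xs)"
      using greedy_curvature_bound[OF picks(1), of S] S picks(2) by auto
    finally have "?m * (curvature_factor ?\<kappa> * optimal_value V f \<alpha> \<beta>) \<le> ?m * f (set xs)"
      by (intro mult_left_mono) (auto simp: le_max_iff_disj)
    also have "\<dots> \<le> ?s"
    proof (cases "1 - ?\<kappa> \<le> 1 / (real \<beta> + 1)")
      case True
      then show ?thesis using survivors_cardinality by (simp add: max_def field_simps)
    next
      case False
      then show ?thesis
        using survivors_curvature[OF bounded_curvature_axioms] by (simp add: max_def)
    qed
    finally show ?thesis by (simp add: mult.assoc)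
  qed
qed

section \<open>Runs of the algorithm\<close>

lemma in_bind_iff:
  "(y, n) \<in> m \<bind> k \<longleftrightarrow> (\<exists>x c d. (x, c) \<in> m \<and> (y, d) \<in> k x \<and> n = c + d)"
  by (auto simp: bind_def)

lemma in_return_iff: "(y, n) \<in> return x \<longleftrightarrow> y = x \<and> n = 0"
  by (auto simp: return_def)

lemma in_any_of_iff: "(y, n) \<in> any_of S \<longleftrightarrow> y \<in> S \<and> n = 0"
  by (auto simp: any_of_def)

lemma bind_singleton: "{(x, c)} \<bind> k = (\<lambda>(y, d). (y, c + d)) ` k x"
  by (auto simp: bind_def)

lemma bind_nonempty:
  assumes "(x, c) \<in> m" "k x \<noteq> {}"
  shows "m \<bind> k \<noteq> {}"
proof -
  obtain y d where "(y, d) \<in> k x" using assms(2) by (metis equals0I surj_pair)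
  then have "(y, c + d) \<in> m \<bind> k" using assms(1) by (auto simp: in_bind_iff)
  then show ?thesis by blast
qed

lemma tabulate_deterministic:
  assumes "\<And>x. g x = {(h x, c)}"
  shows "tabulate g xs = {(map (\<lambda>x. (x, h x)) xs, length xs * c)}"
  by (induction xs) (simp_all add: assms bind_singleton return_def)

lemma tabulate_oracle:
  "tabulate (\<lambda>v. oracle_call f {v}) vs = {(map (\<lambda>v. (v, f {v})) vs, length vs)}"
  using tabulate_deterministic[of "\<lambda>v. oracle_call f {v}" "\<lambda>v. f {v}" 1 vs]
  by (simp add: oracle_call_def)

lemma tabulate_marginal:
  "tabulate (\<lambda>y. marginal (oracle_call f) y X) vs
     = {(map (\<lambda>y. (y, f (insert y X) - f X)) vs, 2 * length vs)}"
  using tabulate_deterministic[of "\<lambda>y. marginal (oracle_call f) y X" "\<lambda>y. f (insert y X) - f X" 2 vs]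
  by (simp add: marginal_def oracle_call_def bind_singleton return_def)

lemma sort_by_value_outcome:
  assumes "(ws, n) \<in> sort_by_value (oracle_call f) vs"
  shows "n = length vs" "mset ws = mset vs" "sorted_wrt (\<lambda>v w. f {w} \<le> f {v}) ws"
proof -
  obtain ps where ps: "ws = map fst ps" "mset ps = mset (map (\<lambda>v. (v, f {v})) vs)"
      "sorted_wrt (\<lambda>p p'. snd p' \<le> snd p) ps" and n: "n = length vs"
    using assms by (auto simp: sort_by_value_def tabulate_oracle bind_singleton in_any_of_iff any_of_def)
  show "n = length vs" by (fact n)
  have "mset (map fst ps) = mset (map fst (map (\<lambda>v. (v, f {v})) vs))"
    using ps(2) by (metis mset_map)
  then show "mset ws = mset vs" using ps(1) by (simp add: comp_def)
  have "set ps = (\<lambda>v. (v, f {v})) ` set vs" using ps(2) by (metis mset_eq_setD set_map)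
  then have "snd p = f {fst p}" if "p \<in> set ps" for p using that by auto
  then show "sorted_wrt (\<lambda>v w. f {w} \<le> f {v}) ws"
    unfolding ps(1) sorted_wrt_map using ps(3) by (auto elim: sorted_wrt_mono_rel[rotated])
qed

lemma sort_by_value_nonempty: "sort_by_value (oracle_call f) vs \<noteq> {}"
proof -
  let ?ps = "map (\<lambda>v. (v, f {v})) vs"
  let ?qs = "sort_key (\<lambda>p. - snd p) ?ps"
  have "sorted (map (\<lambda>p. - snd p) ?qs)" by (rule sorted_sort_key)
  then have "sorted_wrt (\<lambda>p p'. snd p \<ge> snd p') ?qs" by (simp add: sorted_wrt_map)
  moreover have "mset ?qs = mset ?ps" by simp
  ultimately show ?thesis
    unfolding sort_by_value_def tabulate_oracle bind_singleton any_of_def by blast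
qed

lemma prefix_dominates:
  assumes "mset ws = mset vs" "distinct vs" "sorted_wrt (\<lambda>v w. g w \<le> g v) ws" "\<beta> \<le> length vs"
  shows "set (take \<beta> ws) \<subseteq> set vs" "card (set (take \<beta> ws)) = \<beta>"
    and "\<And>a b. a \<in> set (take \<beta> ws) \<Longrightarrow> b \<in> set vs - set (take \<beta> ws) \<Longrightarrow> g b \<le> (g a :: real)"
proof -
  have ws: "set ws = set vs" "distinct ws" "length ws = length vs"
    using assms by (auto dest: mset_eq_setD mset_eq_imp_distinct_iff mset_eq_length)
  show "set (take \<beta> ws) \<subseteq> set vs" using ws set_take_subset by metis
  show "card (set (take \<beta> ws)) = \<beta>" using ws assms by (simp add: distinct_card)
  fix a b
  assume ab: "a \<in> set (take \<beta> ws)" "b \<in> set vs - set (take \<beta> ws)"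
  have "set ws = set (take \<beta> ws) \<union> set (drop \<beta> ws)"
    by (metis append_take_drop_id set_append)
  then have "b \<in> set (drop \<beta> ws)" using ab ws by auto
  moreover have "sorted_wrt (\<lambda>v w. g w \<le> g v) (take \<beta> ws @ drop \<beta> ws)" using assms by simp
  ultimately show "g b \<le> g a" using ab unfolding sorted_wrt_append by blast
qed

lemma best_candidates:
  fixes g :: "'a \<Rightarrow> real"
  shows "fst ` {p. is_arg_max snd (\<lambda>p. p \<in> set (map (\<lambda>y. (y, g y - d)) ys)) p}
           = {x \<in> set ys. \<forall>y\<in>set ys. g y \<le> g x}"
proof (intro subset_antisym subsetI)
  fix x
  assume "x \<in> fst ` {p. is_arg_max snd (\<lambda>p. p \<in> set (map (\<lambda>y. (y, g y - d)) ys)) p}"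
  then show "x \<in> {x \<in> set ys. \<forall>y\<in>set ys. g y \<le> g x}"
    by (force simp: is_arg_max_linorder image_iff)
next
  fix x
  assume "x \<in> {x \<in> set ys. \<forall>y\<in>set ys. g y \<le> g x}"
  then have "is_arg_max snd (\<lambda>p. p \<in> set (map (\<lambda>y. (y, g y - d)) ys)) (x, g x - d)"
    by (auto simp: is_arg_max_linorder)
  then show "x \<in> fst ` {p. is_arg_max snd (\<lambda>p. p \<in> set (map (\<lambda>y. (y, g y - d)) ys)) p}"
    by (intro image_eqI[of _ _ "(x, g x - d)"]) simp_all
qed

text \<open>The table of marginal gains only depends on the oracle, so the nondeterminism of a greedy step is
  reduced to the choice among the best candidates, stated in the form used by \<open>greedy_picks\<close>.\<close>

lemma greedy_loop_unfold:
  "greedy_loop (oracle_call f) vs A1 k A2 =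
     (if length A2 < k then
        let ys = filter (\<lambda>y. y \<notin> A1 \<union> set A2) vs in
        {(map (\<lambda>y. (y, f (insert y (set A2)) - f (set A2))) ys, 2 * length ys)} \<bind>
        (\<lambda>_. any_of {x \<in> set ys. \<forall>y\<in>set ys. f (insert y (set A2)) \<le> f (insert x (set A2))} \<bind>
        (\<lambda>x. greedy_loop (oracle_call f) vs A1 k (x # A2)))
      else return A2)"
  by (subst greedy_loop.simps) (simp only: tabulate_marginal best_candidates bind_singleton Let_def)

text \<open>The loop puts new elements in front of its list, whereas \<open>greedy_picks\<close> lists them in the order
  of their choice; hence the reversal. A step evaluates \<open>f\<close> twice per candidate.\<close>

lemma greedy_loop_outcome:
  assumes "(R, n) \<in> greedy_loop (oracle_call f) vs A1 k A2"
  shows "\<exists>xs. R = rev xs @ A2 \<and> greedy_picks f (set vs - A1) (set A2) xs \<and>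
           length xs = k - length A2 \<and> n \<le> 2 * length vs * (k - length A2)"
  using assms
proof (induction "k - length A2" arbitrary: A2 R n)
  case 0
  then have "(R, n) \<in> return A2" by (simp add: greedy_loop_unfold)
  then show ?case using 0 by (auto simp: in_return_iff intro!: exI[of _ "[]"])
next
  case (Suc j)
  let ?ys = "filter (\<lambda>y. y \<notin> A1 \<union> set A2) vs"
  have "length A2 < k" using Suc.hyps by simp
  then obtain x d where x: "x \<in> set ?ys"
      "\<forall>y\<in>set ?ys. f (insert y (set A2)) \<le> f (insert x (set A2))"
    and run: "(R, d) \<in> greedy_loop (oracle_call f) vs A1 k (x # A2)"
    and n: "n = 2 * length ?ys + d"
    using Suc.prems
    by (subst (asm) greedy_loop_unfold) (auto simp: Let_def in_bind_iff in_any_of_iff)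
  have j: "j = k - length (x # A2)" using Suc.hyps(2) by simp
  obtain xs where xs: "R = rev xs @ x # A2" "greedy_picks f (set vs - A1) (set (x # A2)) xs"
      "length xs = k - length (x # A2)" "d \<le> 2 * length vs * (k - length (x # A2))"
    using Suc.hyps(1)[OF j run] by blast
  have "n \<le> 2 * length vs + 2 * length vs * j"
    using n xs(4) length_filter_le[of "\<lambda>y. y \<notin> A1 \<union> set A2" vs] unfolding j[symmetric] by linarith
  then have "n \<le> 2 * length vs * (k - length A2)" unfolding Suc.hyps(2)[symmetric] by simp
  moreover have "greedy_picks f (set vs - A1) (set A2) (x # xs)" using x xs(2) by auto
  ultimately show ?case using xs j Suc.hyps(2) by (intro exI[of _ "x # xs"]) auto
qed

text \<open>While fewer than \<open>k\<close> elements have been picked, \<open>A1\<close> and the picks together do not exhaust the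
  ground set, so that a best candidate exists.\<close>

lemma greedy_loop_nonempty:
  assumes "finite A1" "card A1 + k \<le> card (set vs)"
  shows "greedy_loop (oracle_call f) vs A1 k A2 \<noteq> {}"
proof (induction "k - length A2" arbitrary: A2)
  case 0
  then show ?case by (simp add: greedy_loop_unfold return_def)
next
  case (Suc j)
  then have less: "length A2 < k" by simp
  let ?ys = "filter (\<lambda>y. y \<notin> A1 \<union> set A2) vs" and ?g = "\<lambda>y. f (insert y (set A2))"
  have "set ?ys \<noteq> {}"
  proof
    assume "set ?ys = {}"
    then have "set vs \<subseteq> A1 \<union> set A2" by auto
    then have "card (set vs) \<le> card (A1 \<union> set A2)"
      using assms(1) by (intro card_mono) auto
    also have "\<dots> \<le> card A1 + length A2"
      using card_Un_le[of A1 "set A2"] card_length[of A2] by linarith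
    finally show False using assms(2) less by simp
  qed
  then have "Max (?g ` set ?ys) \<in> ?g ` set ?ys" by (intro Max_in) auto
  then obtain x where x: "x \<in> set ?ys" "?g x = Max (?g ` set ?ys)" by auto
  then have max: "\<forall>y\<in>set ?ys. ?g y \<le> ?g x" by simp
  have "greedy_loop (oracle_call f) vs A1 k (x # A2) \<noteq> {}"
    using Suc.hyps(1)[of "x # A2"] Suc.hyps(2) by simp
  moreover have "(x, 0) \<in> any_of {x \<in> set ?ys. \<forall>y\<in>set ?ys. ?g y \<le> ?g x}"
    using x(1) max by (simp add: in_any_of_iff)
  ultimately show ?case
    unfolding greedy_loop_unfold[of f vs A1 k A2] Let_def if_P[OF less]
    by (intro bind_nonempty[OF singletonI] bind_nonempty[of x 0])
qed

lemma algorithm_run_outcome: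
  assumes problem: "resilient_problem V f \<alpha> \<beta>" and vs: "distinct vs" "set vs = V"
    and run: "(Ares, n) \<in> algorithm_runs f vs \<alpha> \<beta>"
  obtains A1 xs where "Ares = A1 \<union> set xs" "A1 \<subseteq> V" "card A1 = \<beta>"
    "\<And>a b. a \<in> A1 \<Longrightarrow> b \<in> V - A1 \<Longrightarrow> f {b} \<le> f {a}"
    "greedy_picks f (V - A1) {} xs" "length xs = \<alpha> - \<beta>"
    "n \<le> card V + 2 * card V * (\<alpha> - \<beta>)"
proof -
  have len: "length vs = card V" using vs distinct_card by metis
  have \<beta>: "\<beta> \<le> length vs" using problem len by (simp add: resilient_problem_def)
  obtain ws c R d where sort: "(ws, c) \<in> sort_by_value (oracle_call f) vs"
    and loop: "(R, d) \<in> greedy_loop (oracle_call f) vs (set (take \<beta> ws)) (\<alpha> - \<beta>) []"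
    and out: "Ares = set (take \<beta> ws) \<union> set R" "n = c + d"
    using run by (auto simp: algorithm_runs_def resilient_algorithm_def Let_def in_bind_iff in_return_iff)
  note sorted = sort_by_value_outcome[OF sort]
  obtain xs where xs: "R = rev xs" "greedy_picks f (V - set (take \<beta> ws)) {} xs"
      "length xs = \<alpha> - \<beta>" "d \<le> 2 * length vs * (\<alpha> - \<beta>)"
    using greedy_loop_outcome[OF loop] vs(2) by auto
  note prefix = prefix_dominates[OF sorted(2) vs(1) sorted(3) \<beta>, unfolded vs(2)]
  show thesis
    by (rule that[of "set (take \<beta> ws)" xs])
      (use prefix out xs sorted(1) len in auto)
qed

lemma algorithm_runs_nonempty:
  assumes problem: "resilient_problem V f \<alpha> \<beta>" and vs: "distinct vs" "set vs = V"
  shows "algorithm_runs f vs \<alpha> \<beta> \<noteq> {}"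
proof -
  have len: "length vs = card V" using vs distinct_card by metis
  have \<beta>: "\<beta> \<le> length vs" using problem len by (simp add: resilient_problem_def)
  obtain ws c where sort: "(ws, c) \<in> sort_by_value (oracle_call f) vs"
    using sort_by_value_nonempty[of f vs] by fastforce
  note sorted = sort_by_value_outcome[OF sort]
  have "card (set (take \<beta> ws)) = \<beta>"
    by (rule prefix_dominates(2)[OF sorted(2) vs(1) sorted(3) \<beta>])
  then have "greedy_loop (oracle_call f) vs (set (take \<beta> ws)) (\<alpha> - \<beta>) [] \<noteq> {}"
    using problem vs by (intro greedy_loop_nonempty) (auto simp: resilient_problem_def)
  then obtain R d where "(R, d) \<in> greedy_loop (oracle_call f) vs (set (take \<beta> ws)) (\<alpha> - \<beta>) []"
    by (metis equals0I surj_pair)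
  then show ?thesis
    unfolding algorithm_runs_def resilient_algorithm_def Let_def
    by (intro bind_nonempty[OF sort] bind_nonempty[of R d]) (simp_all add: return_def)
qed

lemma algorithm_output_feasible:
  assumes problem: "resilient_problem V f \<alpha> \<beta>" and vs: "distinct vs" "set vs = V"
    and run: "(Ares, n) \<in> algorithm_runs f vs \<alpha> \<beta>"
  shows "Ares \<subseteq> V" "card Ares \<le> \<alpha>"
proof -
  obtain A1 xs where A: "Ares = A1 \<union> set xs" "A1 \<subseteq> V" "card A1 = \<beta>"
    and xs: "greedy_picks f (V - A1) {} xs" "length xs = \<alpha> - \<beta>"
    using algorithm_run_outcome[OF problem vs run] by metis
  show "Ares \<subseteq> V" using A greedy_picks_subset[OF xs(1)] by auto
  have "card Ares \<le> card A1 + length xs"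
    unfolding A(1) using card_Un_le[of A1 "set xs"] card_length[of xs] by linarith
  then show "card Ares \<le> \<alpha>"
    using A(3) xs(2) problem by (simp add: resilient_problem_def)
qed

lemma algorithm_value:
  assumes problem: "resilient_problem V f \<alpha> \<beta>" and vs: "distinct vs" "set vs = V"
    and run: "(Ares, n) \<in> algorithm_runs f vs \<alpha> \<beta>"
    and removal: "optimal_removal f \<beta> Ares B"
  shows "max (1 - curvature V f) (1 / (real \<beta> + 1)) * curvature_factor (curvature V f)
           * optimal_value V f \<alpha> \<beta> \<le> f (Ares - B)" (is "?bound")
    and "curvature V f = 0 \<Longrightarrow> f (Ares - B) = optimal_value V f \<alpha> \<beta>"
proof -
  obtain A1 xs where A: "Ares = A1 \<union> set xs" "A1 \<subseteq> V" "card A1 = \<beta>"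
      "\<And>a b. a \<in> A1 \<Longrightarrow> b \<in> V - A1 \<Longrightarrow> f {b} \<le> f {a}"
    and xs: "greedy_picks f (V - A1) {} xs" "length xs = \<alpha> - \<beta>"
    using algorithm_run_outcome[OF problem vs run] by metis
  have B: "B \<subseteq> A1 \<union> set xs" "card B \<le> \<beta>"
    using removal A(1) by (auto simp: optimal_removal_def is_arg_min_def)
  show bound: ?bound
    unfolding A(1) using resilient_set_bound[OF problem A(2-4) xs B] .
  show "f (Ares - B) = optimal_value V f \<alpha> \<beta>" if "curvature V f = 0"
  proof (rule antisym)
    show "f (Ares - B) \<le> optimal_value V f \<alpha> \<beta>"
      using problem algorithm_output_feasible[OF problem vs run] removal
      by (intro optimal_value_ge_removal) (auto simp: resilient_problem_def)
    show "optimal_value V f \<alpha> \<beta> \<le> f (Ares - B)"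
      using bound that by (simp add: curvature_factor_def max_def split: if_splits)
  qed
qed

text \<open>For \<open>\<beta> < \<alpha>\<close> the cost of sorting is absorbed by that of a single greedy step; for \<open>\<beta> = \<alpha>\<close> only
  sorting takes place.\<close>

lemma algorithm_cost:
  assumes problem: "resilient_problem V f \<alpha> \<beta>" and vs: "distinct vs" "set vs = V"
    and run: "(Ares, n) \<in> algorithm_runs f vs \<alpha> \<beta>"
  shows "\<beta> < \<alpha> \<Longrightarrow> real n \<le> 3 * (real (card V) * real (\<alpha> - \<beta>))"
    and "\<beta> = \<alpha> \<Longrightarrow> real n \<le> 3 * real (card V)"
proof -
  have n: "n \<le> card V + 2 * card V * (\<alpha> - \<beta>)"
    using algorithm_run_outcome[OF problem vs run] by metis
  show "real n \<le> 3 * real (card V)" if "\<beta> = \<alpha>" using n that by simp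
  assume "\<beta> < \<alpha>"
  then have "card V \<le> card V * (\<alpha> - \<beta>)" using mult_le_mono2[of 1 "\<alpha> - \<beta>" "card V"] by linarith
  then have "n \<le> 3 * (card V * (\<alpha> - \<beta>))" using n unfolding mult.assoc by linarith
  then have "real n \<le> real (3 * (card V * (\<alpha> - \<beta>)))" by (rule of_nat_mono)
  then show "real n \<le> 3 * (real (card V) * real (\<alpha> - \<beta>))" by simp
qed

theorem theorem1:
  shows
    "(\<forall>(V :: 'a set) (f :: 'a set \<Rightarrow> real) (\<alpha> :: nat) (\<beta> :: nat)
        (Bstar :: 'a set \<Rightarrow> 'a set) (vs :: 'a list).
        resilient_problem V f \<alpha> \<beta> \<and>
        (\<forall>A\<subseteq>V. optimal_removal f \<beta> A (Bstar A)) \<and>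
        distinct vs \<and> set vs = V \<longrightarrow>
        algorithm_runs f vs \<alpha> \<beta> \<noteq> {} \<and>
        (\<forall>(Ares, n) \<in> algorithm_runs f vs \<alpha> \<beta>.
           Ares \<subseteq> V \<and> card Ares \<le> \<alpha> \<and>
           f (Ares - Bstar Ares) \<ge>
             max (1 - curvature V f) (1 / (real \<beta> + 1)) * curvature_factor (curvature V f)
               * optimal_value V f \<alpha> \<beta> \<and>
           (curvature V f = 0 \<longrightarrow> f (Ares - Bstar Ares) = optimal_value V f \<alpha> \<beta>)))
     \<and>
     (\<exists>C :: real. C > 0 \<and>
        (\<forall>(V :: 'a set) (f :: 'a set \<Rightarrow> real) (\<alpha> :: nat) (\<beta> :: nat) (vs :: 'a list).
        resilient_problem V f \<alpha> \<beta> \<and> distinct vs \<and> set vs = V \<longrightarrow>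
        (\<forall>(Ares, n) \<in> algorithm_runs f vs \<alpha> \<beta>.
           (\<beta> < \<alpha> \<longrightarrow> real n \<le> C * (real (card V) * real (\<alpha> - \<beta>))) \<and>
           (\<beta> = \<alpha> \<longrightarrow> real n \<le> C * real (card V)))))"
proof (intro conjI allI impI)
  fix V :: "'a set" and f :: "'a set \<Rightarrow> real" and \<alpha> \<beta> :: nat and Bstar vs
  assume a: "resilient_problem V f \<alpha> \<beta> \<and>
        (\<forall>A\<subseteq>V. optimal_removal f \<beta> A (Bstar A)) \<and> distinct vs \<and> set vs = V"
  then have problem: "resilient_problem V f \<alpha> \<beta>" and vs: "distinct vs" "set vs = V" by auto
  show "algorithm_runs f vs \<alpha> \<beta> \<noteq> {}"
    using algorithm_runs_nonempty[OF problem vs] .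
  show "\<forall>(Ares, n) \<in> algorithm_runs f vs \<alpha> \<beta>.
           Ares \<subseteq> V \<and> card Ares \<le> \<alpha> \<and>
           f (Ares - Bstar Ares) \<ge>
             max (1 - curvature V f) (1 / (real \<beta> + 1)) * curvature_factor (curvature V f)
               * optimal_value V f \<alpha> \<beta> \<and>
           (curvature V f = 0 \<longrightarrow> f (Ares - Bstar Ares) = optimal_value V f \<alpha> \<beta>)"
  proof (intro ballI, clarify, intro conjI impI)
    fix Ares n
    assume run: "(Ares, n) \<in> algorithm_runs f vs \<alpha> \<beta>"
    note feasible = algorithm_output_feasible[OF problem vs run]
    show "Ares \<subseteq> V" "card Ares \<le> \<alpha>" by (fact feasible)+
    have removal: "optimal_removal f \<beta> Ares (Bstar Ares)" using a feasible(1) by blast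
    note guarantee = algorithm_value[OF problem vs run removal]
    show "max (1 - curvature V f) (1 / (real \<beta> + 1)) * curvature_factor (curvature V f)
            * optimal_value V f \<alpha> \<beta> \<le> f (Ares - Bstar Ares)"
      by (fact guarantee(1))
    show "f (Ares - Bstar Ares) = optimal_value V f \<alpha> \<beta>" if "curvature V f = 0"
      by (rule guarantee(2)[OF that])
  qed
next
  show "\<exists>C :: real. C > 0 \<and>
        (\<forall>(V :: 'a set) (f :: 'a set \<Rightarrow> real) (\<alpha> :: nat) (\<beta> :: nat) (vs :: 'a list).
        resilient_problem V f \<alpha> \<beta> \<and> distinct vs \<and> set vs = V \<longrightarrow>
        (\<forall>(Ares, n) \<in> algorithm_runs f vs \<alpha> \<beta>.
           (\<beta> < \<alpha> \<longrightarrow> real n \<le> C * (real (card V) * real (\<alpha> - \<beta>))) \<and>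
           (\<beta> = \<alpha> \<longrightarrow> real n \<le> C * real (card V))))"
  proof (intro exI[of _ "3 :: real"] conjI allI impI ballI, simp)
    fix V :: "'a set" and f :: "'a set \<Rightarrow> real" and \<alpha> \<beta> :: nat and vs p
    assume a: "resilient_problem V f \<alpha> \<beta> \<and> distinct vs \<and> set vs = V"
      and p: "p \<in> algorithm_runs f vs \<alpha> \<beta>"
    obtain Ares n where p_eq: "p = (Ares, n)" by (cases p)
    show "case p of (Ares, n) \<Rightarrow>
       (\<beta> < \<alpha> \<longrightarrow> real n \<le> 3 * (real (card V) * real (\<alpha> - \<beta>))) \<and>
       (\<beta> = \<alpha> \<longrightarrow> real n \<le> 3 * real (card V))"
      using algorithm_cost[of V f \<alpha> \<beta> vs Ares n] a p unfolding p_eq prod.case by blast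
  qed
qed

end
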